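(* $\mathbf{JID}$ is a discriminator variety of level $2$; that is, $\mathbf{JID}$ is a discriminator variety and $\mathbf{JID}\subseteq\mathbf{DQD_2}$.
   Context: A semi-Heyting algebra is an algebra $\langle L,\vee,\wedge,\to,0,1\rangle$ such that $\langle L,\vee,\wedge,0,1\rangle$ is a bounded lattice and the identities $x\wedge(x\to y)\approx x\wedge y$, $x\wedge(y\to z)\approx x\wedge[(x\wedge y)\to(x\wedge z)]$, $x\to x\approx 1$ hold; write $x^*:=x\to 0$. A $\mathbf{DQD}$-algebra (dually quasi-De Morgan semi-Heyting algebra) is an algebra $\langle L,\vee,\wedge,\to,{}',0,1\rangle$ whose reduct $\langle L,\vee,\wedge,\to,0,1\rangle$ is a semi-Heyting algebra and which satisfies: $0'\approx 1$ and $1'\approx 0$; $(x\wedge y)'\approx x'\vee y'$; $(x\vee y)''\approx x''\vee y''$; $x''\le x$. $\mathbf{DQD}$ denotes the variety of all $\mathbf{DQD}$-algebras. $\mathbf{JID}$ is the subvariety of $\mathbf{DQD}$ defined by $x'\vee(y\to z)\approx(x'\vee y)\to(x'\vee z)$. Levels: put $x^{(0)}:=x$ and $x^{(n+1)}:=((x^{(n)})')^*$; put $t_0(x):=x$ and $t_{n+1}(x):=t_n(x)\wedge x^{(n+1)}$. $\mathbf{DQD_n}$ is the subvariety of $\mathbf{DQD}$ defined by $t_n(x)\approx t_{n+1}(x)$. A discriminator variety is one generated by a class of algebras on all of which a single ternary term $t$ represents the discriminator function ($t(x,x,z)=z$ and $t(x,y,z)=x$ if $x\ne y$). *)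

theory Defs
  imports Main
begin

text \<open>
  Algebras of type \<open>(\<or>, \<and>, \<rightarrow>, ', 0, 1)\<close> with an explicit carrier, so that a class of algebras
  is a set of records over a type \<open>'a\<close> serving as the universe of discourse. The values of
  the operations outside the carrier are irrelevant.
\<close>

record 'a dqd_sig =
  carrier :: "'a set"
  join :: "'a \<Rightarrow> 'a \<Rightarrow> 'a" (infixl "\<squnion>\<index>" 65)
  meet :: "'a \<Rightarrow> 'a \<Rightarrow> 'a" (infixl "\<sqinter>\<index>" 70)
  imp :: "'a \<Rightarrow> 'a \<Rightarrow> 'a" (infixr "\<leadsto>\<index>" 60)
  dneg :: "'a \<Rightarrow> 'a" ("_\<acute>\<index>" [90] 90)
  zero_elem :: 'a ("\<zero>\<index>")
  one_elem :: 'a ("\<one>\<index>")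

locale sig_algebra =
  fixes L :: "'a dqd_sig" (structure)
  assumes join_closed: "\<lbrakk>x \<in> carrier L; y \<in> carrier L\<rbrakk> \<Longrightarrow> x \<squnion> y \<in> carrier L"
    and meet_closed: "\<lbrakk>x \<in> carrier L; y \<in> carrier L\<rbrakk> \<Longrightarrow> x \<sqinter> y \<in> carrier L"
    and imp_closed: "\<lbrakk>x \<in> carrier L; y \<in> carrier L\<rbrakk> \<Longrightarrow> (x \<leadsto> y) \<in> carrier L"
    and dneg_closed: "x \<in> carrier L \<Longrightarrow> x\<acute> \<in> carrier L"
    and bot_closed: "\<zero> \<in> carrier L"
    and top_closed: "\<one> \<in> carrier L"

locale bounded_lattice_algebra = sig_algebra +
  assumes join_commute: "\<lbrakk>x \<in> carrier L; y \<in> carrier L\<rbrakk> \<Longrightarrow> x \<squnion> y = y \<squnion> x"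
    and meet_commute: "\<lbrakk>x \<in> carrier L; y \<in> carrier L\<rbrakk> \<Longrightarrow> x \<sqinter> y = y \<sqinter> x"
    and join_assoc: "\<lbrakk>x \<in> carrier L; y \<in> carrier L; z \<in> carrier L\<rbrakk>
          \<Longrightarrow> (x \<squnion> y) \<squnion> z = x \<squnion> (y \<squnion> z)"
    and meet_assoc: "\<lbrakk>x \<in> carrier L; y \<in> carrier L; z \<in> carrier L\<rbrakk>
          \<Longrightarrow> (x \<sqinter> y) \<sqinter> z = x \<sqinter> (y \<sqinter> z)"
    and join_meet_absorb: "\<lbrakk>x \<in> carrier L; y \<in> carrier L\<rbrakk> \<Longrightarrow> x \<squnion> (x \<sqinter> y) = x"
    and meet_join_absorb: "\<lbrakk>x \<in> carrier L; y \<in> carrier L\<rbrakk> \<Longrightarrow> x \<sqinter> (x \<squnion> y) = x"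
    and meet_bot: "x \<in> carrier L \<Longrightarrow> x \<sqinter> \<zero> = \<zero>"
    and join_top: "x \<in> carrier L \<Longrightarrow> x \<squnion> \<one> = \<one>"

locale semi_heyting_algebra = bounded_lattice_algebra +
  assumes meet_imp: "\<lbrakk>x \<in> carrier L; y \<in> carrier L\<rbrakk> \<Longrightarrow> x \<sqinter> (x \<leadsto> y) = x \<sqinter> y"
    and meet_imp_meet: "\<lbrakk>x \<in> carrier L; y \<in> carrier L; z \<in> carrier L\<rbrakk>
          \<Longrightarrow> x \<sqinter> (y \<leadsto> z) = x \<sqinter> ((x \<sqinter> y) \<leadsto> (x \<sqinter> z))"
    and imp_refl: "x \<in> carrier L \<Longrightarrow> (x \<leadsto> x) = \<one>"

text \<open>The law \<open>x'' \<le> x\<close> is written as the equation \<open>x'' \<and> x = x''\<close>.\<close>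

locale dqd_algebra = semi_heyting_algebra +
  assumes dneg_bot: "\<zero>\<acute> = \<one>"
    and dneg_top: "\<one>\<acute> = \<zero>"
    and dneg_meet: "\<lbrakk>x \<in> carrier L; y \<in> carrier L\<rbrakk> \<Longrightarrow> (x \<sqinter> y)\<acute> = x\<acute> \<squnion> y\<acute>"
    and dneg_dneg_join: "\<lbrakk>x \<in> carrier L; y \<in> carrier L\<rbrakk>
          \<Longrightarrow> (x \<squnion> y)\<acute>\<acute> = x\<acute>\<acute> \<squnion> y\<acute>\<acute>"
    and dneg_dneg_le: "x \<in> carrier L \<Longrightarrow> x\<acute>\<acute> \<sqinter> x = x\<acute>\<acute>"

locale jid_algebra = dqd_algebra +
  assumes join_imp_distrib: "\<lbrakk>x \<in> carrier L; y \<in> carrier L; z \<in> carrier L\<rbrakk>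
    \<Longrightarrow> x\<acute> \<squnion> (y \<leadsto> z) = ((x\<acute> \<squnion> y) \<leadsto> (x\<acute> \<squnion> z))"

definition DQD :: "'a dqd_sig set" where
  "DQD = {L. dqd_algebra L}"

definition JID :: "'a dqd_sig set" where
  "JID = {L. jid_algebra L}"

definition pstar :: "'a dqd_sig \<Rightarrow> 'a \<Rightarrow> 'a" where
  "pstar L x = (x \<leadsto>\<^bsub>L\<^esub> \<zero>\<^bsub>L\<^esub>)"

primrec level_iter :: "'a dqd_sig \<Rightarrow> nat \<Rightarrow> 'a \<Rightarrow> 'a" where
  "level_iter L 0 x = x"
| "level_iter L (Suc n) x = pstar L ((level_iter L n x)\<acute>\<^bsub>L\<^esub>)"

primrec level_meet :: "'a dqd_sig \<Rightarrow> nat \<Rightarrow> 'a \<Rightarrow> 'a" where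
  "level_meet L 0 x = x"
| "level_meet L (Suc n) x = level_meet L n x \<sqinter>\<^bsub>L\<^esub> level_iter L (Suc n) x"

definition DQD_level :: "nat \<Rightarrow> 'a dqd_sig set" where
  "DQD_level n = {L \<in> DQD. \<forall>x\<in>carrier L. level_meet L n x = level_meet L (Suc n) x}"

datatype sig_term =
    Var nat
  | Join sig_term sig_term
  | Meet sig_term sig_term
  | Imp sig_term sig_term
  | DNeg sig_term
  | Bot
  | Top

primrec term_val :: "'a dqd_sig \<Rightarrow> (nat \<Rightarrow> 'a) \<Rightarrow> sig_term \<Rightarrow> 'a" where
  "term_val L v (Var i) = v i"
| "term_val L v (Join s t) = term_val L v s \<squnion>\<^bsub>L\<^esub> term_val L v t"
| "term_val L v (Meet s t) = term_val L v s \<sqinter>\<^bsub>L\<^esub> term_val L v t"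
| "term_val L v (Imp s t) = (term_val L v s \<leadsto>\<^bsub>L\<^esub> term_val L v t)"
| "term_val L v (DNeg s) = (term_val L v s)\<acute>\<^bsub>L\<^esub>"
| "term_val L v Bot = \<zero>\<^bsub>L\<^esub>"
| "term_val L v Top = \<one>\<^bsub>L\<^esub>"

primrec term_vars :: "sig_term \<Rightarrow> nat set" where
  "term_vars (Var i) = {i}"
| "term_vars (Join s t) = term_vars s \<union> term_vars t"
| "term_vars (Meet s t) = term_vars s \<union> term_vars t"
| "term_vars (Imp s t) = term_vars s \<union> term_vars t"
| "term_vars (DNeg s) = term_vars s"
| "term_vars Bot = {}"
| "term_vars Top = {}"

definition satisfies_identity :: "'a dqd_sig \<Rightarrow> sig_term \<times> sig_term \<Rightarrow> bool" where
  "satisfies_identity L e \<longleftrightarrow>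
    (\<forall>v. range v \<subseteq> carrier L \<longrightarrow> term_val L v (fst e) = term_val L v (snd e))"

definition equational_class :: "(sig_term \<times> sig_term) set \<Rightarrow> 'a dqd_sig set" where
  "equational_class E = {L. sig_algebra L \<and> (\<forall>e\<in>E. satisfies_identity L e)}"

definition variety :: "'a dqd_sig set \<Rightarrow> bool" where
  "variety V \<longleftrightarrow> (\<exists>E. V = equational_class E)"

text \<open>
  The smallest variety containing \<open>K\<close>. Varieties are taken as equational classes and not as
  classes closed under homomorphic images, subalgebras and products, because the carrier of a
  product of algebras over \<open>'a\<close> need not fit into the type \<open>'a\<close>.
\<close>

definition variety_generated_by :: "'a dqd_sig set \<Rightarrow> 'a dqd_sig set" where
  "variety_generated_by K = \<Inter>{V. variety V \<and> K \<subseteq> V}"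

definition represents_discriminator :: "sig_term \<Rightarrow> 'a dqd_sig \<Rightarrow> bool" where
  "represents_discriminator t L \<longleftrightarrow>
    term_vars t \<subseteq> {0, 1, 2} \<and>
    (\<forall>v. range v \<subseteq> carrier L \<longrightarrow>
      term_val L v t = (if v 0 = v 1 then v 2 else v 0))"

definition discriminator_variety :: "'a dqd_sig set \<Rightarrow> bool" where
  "discriminator_variety V \<longleftrightarrow>
    (\<exists>K t. (\<forall>L\<in>K. sig_algebra L \<and> represents_discriminator t L) \<and>
           V = variety_generated_by K)"

end

theory Submission
  imports Defs
begin

text \<open>
  In a JID-algebra every \<open>x'\<close> is complemented: \<open>x' \<or> x'* = (x' \<rightarrow> x') = 1\<close> is an instance of the
  defining identity. Since \<open>(x \<or> y)'' = x'' \<or> y''\<close>, the dual negation of \<open>x'*\<close> is the complement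
  of \<open>x''\<close>, that is \<open>x'*'* = x''\<close> (\<open>pstar_dneg_pstar_dneg\<close>). Together with \<open>x''' = x'\<close> this
  makes the iterates \<open>x'*\<close>, \<open>x''\<close>, \<open>x'*\<close>, \<dots> periodic, whence level 2.

  The element \<open>x'' \<and> x'*\<close>, here called the core of \<open>x\<close>, lies below \<open>x\<close> and is central: its
  dual negation is its complement (\<open>central_core\<close>). A central element \<open>e\<close> yields the congruence
  \<open>x \<and> e = y \<and> e\<close>. If \<open>0\<close> and \<open>1\<close> are the only central elements, then \<open>core x = 0\<close> for all \<open>x\<close>
  except \<open>x = 1\<close>. As \<open>x = y\<close> exactly when \<open>(x \<rightarrow> y) \<and> (y \<rightarrow> x) = 1\<close>, the core of the latter
  decides equality, and a term for the discriminator results.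

  The JID-algebras in which the core takes only the values \<open>0\<close> and \<open>1\<close> generate JID.
  For \<open>a \<noteq> b\<close>, Zorn's lemma gives an ultrafilter of
  central elements none of which identifies \<open>a\<close> and \<open>b\<close>; the quotient by it has a two-valued core
  and separates \<open>a\<close> from \<open>b\<close> (\<open>separating_quotient\<close>). So an identity failing in a JID-algebra
  fails in a quotient on which the term represents the discriminator. Conversely, JID is itself
  an equational class, hence contains the variety generated by those of its members on which
  the term represents the discriminator.
\<close>


section \<open>Bounded lattices and semi-Heyting algebras\<close>

context sig_algebra
begin

lemmas closed [simp, intro] =
  join_closed meet_closed imp_closed dneg_closed bot_closed top_closed

lemma pstar_closed [simp, intro]: "x \<in> carrier L \<Longrightarrow> pstar L x \<in> carrier L"
  by (simp add: pstar_def)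

lemma term_val_closed: "range v \<subseteq> carrier L \<Longrightarrow> term_val L v t \<in> carrier L"
  by (induction t) auto

end

context bounded_lattice_algebra
begin

lemma meet_left_commute:
  "\<lbrakk>x \<in> carrier L; y \<in> carrier L; z \<in> carrier L\<rbrakk> \<Longrightarrow> x \<sqinter> (y \<sqinter> z) = y \<sqinter> (x \<sqinter> z)"
  by (metis meet_assoc meet_commute)

lemma join_left_commute:
  "\<lbrakk>x \<in> carrier L; y \<in> carrier L; z \<in> carrier L\<rbrakk> \<Longrightarrow> x \<squnion> (y \<squnion> z) = y \<squnion> (x \<squnion> z)"
  by (metis join_assoc join_commute)

lemmas meet_ac = meet_assoc meet_commute meet_left_commute
lemmas join_ac = join_assoc join_commute join_left_commute

lemma meet_idem [simp]: "x \<in> carrier L \<Longrightarrow> x \<sqinter> x = x"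
  by (metis join_meet_absorb meet_closed meet_join_absorb)

lemma meet_left_idem [simp]:
  "\<lbrakk>x \<in> carrier L; y \<in> carrier L\<rbrakk> \<Longrightarrow> x \<sqinter> (x \<sqinter> y) = x \<sqinter> y"
  by (metis meet_assoc meet_idem)

lemma join_idem [simp]: "x \<in> carrier L \<Longrightarrow> x \<squnion> x = x"
  by (metis join_meet_absorb meet_idem)

lemma bounds [simp]:
  assumes "x \<in> carrier L"
  shows "x \<sqinter> \<zero> = \<zero>" "\<zero> \<sqinter> x = \<zero>" "x \<squnion> \<one> = \<one>" "\<one> \<squnion> x = \<one>"
    and "x \<squnion> \<zero> = x" "\<zero> \<squnion> x = x" "x \<sqinter> \<one> = x" "\<one> \<sqinter> x = x"
proof -
  show 1: "x \<sqinter> \<zero> = \<zero>" and 2: "x \<squnion> \<one> = \<one>"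
    using assms by (simp_all add: meet_bot join_top)
  show 3: "\<zero> \<sqinter> x = \<zero>" and 4: "\<one> \<squnion> x = \<one>"
    using assms 1 2 meet_commute[of x "\<zero>"] join_commute[of x "\<one>"] by simp_all
  show 5: "x \<squnion> \<zero> = x" and 6: "x \<sqinter> \<one> = x"
    using assms 1 2 join_meet_absorb[of x "\<zero>"] meet_join_absorb[of x "\<one>"] by simp_all
  show "\<zero> \<squnion> x = x" and "\<one> \<sqinter> x = x"
    using assms 5 6 join_commute[of x "\<zero>"] meet_commute[of x "\<one>"] by simp_all
qed

lemma meet_eq_topD:
  assumes [simp]: "x \<in> carrier L" "y \<in> carrier L" and eq: "x \<sqinter> y = \<one>"
  shows "x = \<one>" and "y = \<one>"
proof -
  show "x = \<one>"
    using join_meet_absorb[of x y] eq by simp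
  show "y = \<one>"
    using join_meet_absorb[of y x] eq by (simp add: meet_commute)
qed

lemma meet_eq_iff_join_eq:
  "\<lbrakk>x \<in> carrier L; y \<in> carrier L\<rbrakk> \<Longrightarrow> x \<sqinter> y = x \<longleftrightarrow> x \<squnion> y = y"
  by (metis join_commute join_meet_absorb meet_commute meet_join_absorb)

lemma join_least:
  assumes "x \<in> carrier L" "y \<in> carrier L" "z \<in> carrier L" "x \<sqinter> z = x" "y \<sqinter> z = y"
  shows "(x \<squnion> y) \<sqinter> z = x \<squnion> y"
  using assms by (metis join_assoc join_closed meet_eq_iff_join_eq)

end

context semi_heyting_algebra
begin

text \<open>
  The operation \<open>x \<rightarrow> (x \<and> w)\<close> is residuated with respect to meet, so meets distribute over
  joins.
\<close>

lemma meet_join_distrib: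
  assumes [simp]: "x \<in> carrier L" "y \<in> carrier L" "z \<in> carrier L"
  shows "x \<sqinter> (y \<squnion> z) = (x \<sqinter> y) \<squnion> (x \<sqinter> z)"
proof -
  define w where "w = (x \<sqinter> y) \<squnion> (x \<sqinter> z)"
  define h where "h = (x \<leadsto> (x \<sqinter> w))"
  have [simp]: "w \<in> carrier L" "h \<in> carrier L"
    by (simp_all add: w_def h_def)
  have below_h: "u \<sqinter> h = u" if u: "u \<in> carrier L" "(x \<sqinter> u) \<sqinter> w = x \<sqinter> u" for u
  proof -
    have "u \<sqinter> (x \<sqinter> w) = u \<sqinter> x"
      using u by (metis \<open>w \<in> carrier L\<close> assms(1) meet_assoc meet_commute)
    then show ?thesis
      using u meet_imp_meet[of u x "x \<sqinter> w"] by (simp add: h_def imp_refl)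
  qed
  have "(x \<sqinter> y) \<sqinter> w = x \<sqinter> y" "(x \<sqinter> z) \<sqinter> w = x \<sqinter> z"
    unfolding w_def using meet_join_absorb[of "x \<sqinter> y" "x \<sqinter> z"]
      meet_join_absorb[of "x \<sqinter> z" "x \<sqinter> y"] join_commute[of "x \<sqinter> y" "x \<sqinter> z"] by simp_all
  then have "(y \<squnion> z) \<sqinter> h = y \<squnion> z"
    by (simp add: below_h join_least)
  then have "x \<sqinter> (y \<squnion> z) = x \<sqinter> ((y \<squnion> z) \<sqinter> h)"
    by simp
  also have "\<dots> = (x \<sqinter> h) \<sqinter> (y \<squnion> z)"
    by (simp add: meet_ac)
  also have "\<dots> = w \<sqinter> (x \<sqinter> (y \<squnion> z))"
    by (simp add: h_def meet_imp meet_ac)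
  also have "\<dots> = w"
  proof -
    have "(x \<sqinter> y) \<sqinter> (x \<sqinter> (y \<squnion> z)) = x \<sqinter> y"
      by (simp add: meet_assoc meet_left_commute[of y x] meet_join_absorb)
    moreover have "(x \<sqinter> z) \<sqinter> (x \<sqinter> (y \<squnion> z)) = x \<sqinter> z"
      by (simp add: meet_assoc meet_left_commute[of z x] join_commute[of y z] meet_join_absorb)
    ultimately show ?thesis
      by (simp add: w_def join_least)
  qed
  finally show ?thesis
    by (simp add: w_def)
qed

lemma join_meet_distrib:
  assumes [simp]: "x \<in> carrier L" "y \<in> carrier L" "z \<in> carrier L"
  shows "(x \<squnion> y) \<sqinter> z = (x \<sqinter> z) \<squnion> (y \<sqinter> z)"
  using meet_join_distrib[of z x y] by (simp add: meet_commute)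

lemma meet_pstar: "x \<in> carrier L \<Longrightarrow> x \<sqinter> pstar L x = \<zero>"
  by (simp add: pstar_def meet_imp)

lemma disjoint_below_cover:
  assumes [simp]: "x \<in> carrier L" "y \<in> carrier L" "z \<in> carrier L"
    and "x \<sqinter> y = \<zero>" "x \<squnion> z = \<one>"
  shows "y \<sqinter> z = y"
  using meet_join_distrib[of y x z] assms meet_commute[of y x] by simp

lemma pstar_eqI:
  assumes [simp]: "x \<in> carrier L" "y \<in> carrier L"
    and disj: "x \<sqinter> y = \<zero>" and cov: "x \<squnion> y = \<one>"
  shows "pstar L x = y"
proof -
  have "y \<sqinter> pstar L x = y"
    using disj meet_imp_meet[of y x "\<zero>"] meet_commute[of x y] imp_refl[of "\<zero>"]
    by (simp add: pstar_def)
  moreover have "pstar L x \<sqinter> y = pstar L x"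
    by (rule disjoint_below_cover[of x]) (simp_all add: meet_pstar cov)
  ultimately show ?thesis
    by (metis assms(1,2) meet_commute pstar_closed)
qed

lemma eq_iff_imps_eq_top:
  assumes [simp]: "x \<in> carrier L" "y \<in> carrier L"
  shows "(x \<leadsto> y) \<sqinter> (y \<leadsto> x) = \<one> \<longleftrightarrow> x = y"
proof
  assume eq: "(x \<leadsto> y) \<sqinter> (y \<leadsto> x) = \<one>"
  then have "(x \<leadsto> y) = \<one>" "(y \<leadsto> x) = \<one>"
    using meet_eq_topD[of "x \<leadsto> y" "y \<leadsto> x"] by simp_all
  then show "x = y"
    using meet_imp[of x y] meet_imp[of y x] meet_commute[of x y] by simp
qed (simp add: imp_refl)

end


section \<open>Central elements and the level of JID\<close>

context dqd_algebra
begin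

lemma dneg_dneg_dneg:
  assumes [simp]: "x \<in> carrier L"
  shows "x\<acute>\<acute>\<acute> = x\<acute>"
proof -
  have "x\<acute>\<acute>\<acute> \<squnion> x\<acute> = x\<acute>\<acute>\<acute>"
    using dneg_meet[of "x\<acute>\<acute>" x] by (simp add: dneg_dneg_le)
  moreover have "x\<acute>\<acute>\<acute> \<squnion> x\<acute> = x\<acute>"
    using dneg_dneg_le[of "x\<acute>"] by (simp add: meet_eq_iff_join_eq)
  ultimately show ?thesis
    by simp
qed

text \<open>
  The elements complemented by their dual negation. Each of them decomposes the algebra into a
  direct product of two factors.
\<close>

definition central :: "'a \<Rightarrow> bool" where
  "central e \<longleftrightarrow> e \<in> carrier L \<and> e \<sqinter> e\<acute> = \<zero> \<and> e \<squnion> e\<acute> = \<one>"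

lemma central_closed [simp]: "central e \<Longrightarrow> e \<in> carrier L"
  by (simp add: central_def)

lemma central_top: "central \<one>"
  by (simp add: central_def dneg_top)

lemma central_dneg:
  assumes "central e"
  shows "central (e\<acute>)"
proof -
  have [simp]: "e \<in> carrier L" and disj: "e \<sqinter> e\<acute> = \<zero>"
    using assms by (auto simp: central_def)
  have cov: "e\<acute> \<squnion> e\<acute>\<acute> = \<one>"
    using dneg_meet[of e "e\<acute>"] by (simp add: disj dneg_bot)
  have "e\<acute> \<sqinter> e\<acute>\<acute> = e\<acute> \<sqinter> (e \<sqinter> e\<acute>\<acute>)"
    using dneg_dneg_le[of e] by (simp add: meet_commute)
  also have "\<dots> = \<zero>"
    using disj by (simp add: meet_assoc[symmetric] meet_commute)
  finally show ?thesis
    using cov by (simp add: central_def)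
qed

lemma central_meet:
  assumes "central e" "central f"
  shows "central (e \<sqinter> f)"
proof -
  have [simp]: "e \<in> carrier L" "f \<in> carrier L" "e \<sqinter> e\<acute> = \<zero>" "e \<squnion> e\<acute> = \<one>" "f \<sqinter> f\<acute> = \<zero>" "f \<squnion> f\<acute> = \<one>"
    using assms by (auto simp: central_def)
  have "(e \<sqinter> f) \<sqinter> (e\<acute> \<squnion> f\<acute>) = (f \<sqinter> (e \<sqinter> e\<acute>)) \<squnion> (e \<sqinter> (f \<sqinter> f\<acute>))"
    unfolding meet_join_distrib[of "e \<sqinter> f" "e\<acute>" "f\<acute>", simplified]
    by (simp only: meet_ac closed \<open>e \<in> carrier L\<close> \<open>f \<in> carrier L\<close>)
  then have disj: "(e \<sqinter> f) \<sqinter> (e\<acute> \<squnion> f\<acute>) = \<zero>"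
    by simp
  have split: "e = (e \<sqinter> f) \<squnion> (e \<sqinter> f\<acute>)"
    using meet_join_distrib[of e f "f\<acute>"] by simp
  have "(e \<sqinter> f) \<squnion> (e\<acute> \<squnion> f\<acute>) = (e \<sqinter> f) \<squnion> (e\<acute> \<squnion> (f\<acute> \<squnion> (f\<acute> \<sqinter> e)))"
    by (simp add: join_meet_absorb)
  also have "\<dots> = (((e \<sqinter> f) \<squnion> (e \<sqinter> f\<acute>)) \<squnion> e\<acute>) \<squnion> f\<acute>"
    by (simp add: join_ac meet_commute)
  also have "\<dots> = \<one>"
    unfolding split[symmetric] by simp
  finally have "(e \<sqinter> f) \<squnion> (e\<acute> \<squnion> f\<acute>) = \<one>" .
  with disj show ?thesis
    by (simp add: central_def dneg_meet)
qed

text \<open>The largest central element below \<open>x\<close> in an algebra in which all \<open>x'\<close> are complemented.\<close>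

definition core :: "'a \<Rightarrow> 'a" where
  "core x = x\<acute>\<acute> \<sqinter> pstar L (x\<acute>)"

lemma core_closed [simp]: "x \<in> carrier L \<Longrightarrow> core x \<in> carrier L"
  by (simp add: core_def)

lemma core_top: "core \<one> = \<one>"
  by (simp add: core_def dneg_top dneg_bot pstar_def imp_refl)

lemma core_eq_top_iff:
  assumes [simp]: "x \<in> carrier L"
  shows "core x = \<one> \<longleftrightarrow> x = \<one>"
proof
  assume "core x = \<one>"
  then have "x\<acute>\<acute> = \<one>"
    using meet_eq_topD[of "x\<acute>\<acute>" "pstar L (x\<acute>)"] by (simp add: core_def)
  then show "x = \<one>"
    using dneg_dneg_le[of x] by simp
qed (simp add: core_top)

end

context jid_algebra
begin

text \<open>The instance \<open>y := x'\<close>, \<open>z := 0\<close> of the defining identity of JID.\<close>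

lemma join_dneg_pstar: "x \<in> carrier L \<Longrightarrow> x\<acute> \<squnion> pstar L (x\<acute>) = \<one>"
  using join_imp_distrib[of x "x\<acute>" "\<zero>"] by (simp add: pstar_def imp_refl)

text \<open>The dual negation of \<open>x'*\<close> is the complement of \<open>x''\<close>.\<close>

lemma dneg_pstar_dneg_complement:
  assumes [simp]: "x \<in> carrier L"
  shows "(pstar L (x\<acute>))\<acute> \<squnion> x\<acute>\<acute> = \<one>" and "(pstar L (x\<acute>))\<acute> \<sqinter> x\<acute>\<acute> = \<zero>"
proof -
  define c d where "c = x\<acute>" and "d = pstar L (x\<acute>)"
  have [simp]: "c \<in> carrier L" "d \<in> carrier L"
    by (simp_all add: c_def d_def)
  have cd: "c \<sqinter> d = \<zero>" "c \<squnion> d = \<one>"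
    by (simp_all add: c_def d_def meet_pstar join_dneg_pstar)
  show "(pstar L (x\<acute>))\<acute> \<squnion> x\<acute>\<acute> = \<one>"
    using dneg_meet[of c d] cd by (simp add: dneg_bot c_def d_def join_commute)
  define m n where "m = d\<acute> \<sqinter> c\<acute>" and "n = pstar L (d\<acute>) \<squnion> pstar L (c\<acute>)"
  have [simp]: "m \<in> carrier L" "n \<in> carrier L"
    by (simp_all add: m_def n_def)
  \<comment> \<open>As a meet of two dual negations, \<open>m\<close> is complemented by \<open>n\<close>; and \<open>m'' = 0\<close>, so \<open>n'' = 1\<close>.\<close>
  have "m\<acute> = \<one>"
    using dneg_dneg_join[of d c] cd join_commute[of c d]
    by (simp add: m_def dneg_meet dneg_top dneg_bot)
  have "d\<acute> = d\<acute> \<sqinter> (c\<acute> \<squnion> pstar L (c\<acute>))"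
    by (simp add: join_dneg_pstar)
  also have "\<dots> = m \<squnion> (d\<acute> \<sqinter> pstar L (c\<acute>))"
    by (simp add: meet_join_distrib m_def)
  finally have split: "d\<acute> = m \<squnion> (d\<acute> \<sqinter> pstar L (c\<acute>))" .
  have "m \<squnion> n = m \<squnion> (pstar L (d\<acute>) \<squnion> (pstar L (c\<acute>) \<squnion> (pstar L (c\<acute>) \<sqinter> d\<acute>)))"
    by (simp add: join_meet_absorb n_def)
  also have "\<dots> = ((m \<squnion> (d\<acute> \<sqinter> pstar L (c\<acute>))) \<squnion> pstar L (d\<acute>)) \<squnion> pstar L (c\<acute>)"
    by (simp add: join_ac meet_commute)
  also have "\<dots> = \<one>"
    unfolding split[symmetric] by (simp add: join_dneg_pstar)
  finally have "m \<squnion> n = \<one>" .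
  then have "n\<acute>\<acute> = \<one>"
    using dneg_dneg_join[of m n] by (simp add: \<open>m\<acute> = \<one>\<close> dneg_top dneg_bot)
  then have "n = \<one>"
    using dneg_dneg_le[of n] by simp
  have "m \<sqinter> pstar L (d\<acute>) = \<zero>" "m \<sqinter> pstar L (c\<acute>) = \<zero>"
    using meet_pstar[of "d\<acute>"] meet_pstar[of "c\<acute>"] unfolding m_def
    by (simp_all add: meet_assoc meet_left_commute[of "d\<acute>" "c\<acute>"])
  then have "m \<sqinter> n = \<zero>"
    by (simp add: n_def meet_join_distrib)
  then have "m = \<zero>"
    by (simp add: \<open>n = \<one>\<close>)
  then show "(pstar L (x\<acute>))\<acute> \<sqinter> x\<acute>\<acute> = \<zero>"
    by (simp add: m_def c_def d_def)
qed

lemma central_core: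
  assumes [simp]: "x \<in> carrier L"
  shows "central (core x)"
proof -
  define d where "d = pstar L (x\<acute>)"
  have [simp]: "d \<in> carrier L"
    by (simp add: d_def)
  have cd: "x\<acute> \<sqinter> d = \<zero>" "x\<acute> \<squnion> d = \<one>"
    by (simp_all add: d_def meet_pstar join_dneg_pstar)
  have cd': "x\<acute>\<acute> \<squnion> d\<acute> = \<one>" "x\<acute>\<acute> \<sqinter> d\<acute> = \<zero>"
    using dneg_pstar_dneg_complement[of x]
    by (simp_all add: d_def meet_commute join_commute)
  have dual: "(core x)\<acute> = x\<acute> \<squnion> d\<acute>"
    by (simp add: core_def d_def dneg_meet dneg_dneg_dneg)
  have "core x \<sqinter> (x\<acute> \<squnion> d\<acute>) = (x\<acute>\<acute> \<sqinter> (x\<acute> \<sqinter> d)) \<squnion> (d \<sqinter> (x\<acute>\<acute> \<sqinter> d\<acute>))"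
    unfolding core_def d_def[symmetric] meet_join_distrib[of "x\<acute>\<acute> \<sqinter> d" "x\<acute>" "d\<acute>", simplified]
    by (simp only: meet_ac closed \<open>d \<in> carrier L\<close> \<open>x \<in> carrier L\<close>)
  then have disj: "core x \<sqinter> (x\<acute> \<squnion> d\<acute>) = \<zero>"
    by (simp add: cd cd')
  have "d = d \<sqinter> (x\<acute>\<acute> \<squnion> d\<acute>)"
    by (simp add: cd')
  also have "\<dots> = core x \<squnion> (d \<sqinter> d\<acute>)"
    by (simp add: meet_join_distrib core_def d_def[symmetric] meet_commute)
  finally have split: "d = core x \<squnion> (d \<sqinter> d\<acute>)" .
  have "core x \<squnion> (x\<acute> \<squnion> d\<acute>) = core x \<squnion> (x\<acute> \<squnion> (d\<acute> \<squnion> (d\<acute> \<sqinter> d)))"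
    by (simp add: join_meet_absorb)
  also have "\<dots> = (x\<acute> \<squnion> (core x \<squnion> (d \<sqinter> d\<acute>))) \<squnion> d\<acute>"
    by (simp add: join_ac meet_commute)
  also have "\<dots> = \<one>"
    unfolding split[symmetric] by (simp add: cd)
  finally have "core x \<squnion> (x\<acute> \<squnion> d\<acute>) = \<one>" .
  with disj show ?thesis
    by (simp add: central_def dual)
qed

lemma pstar_dneg_pstar_dneg:
  "x \<in> carrier L \<Longrightarrow> pstar L ((pstar L (x\<acute>))\<acute>) = x\<acute>\<acute>"
  by (rule pstar_eqI) (simp_all add: dneg_pstar_dneg_complement)

text \<open>The third iterate \<open>x'*'*'* = x'''*\<close> equals the first iterate \<open>x'*\<close>.\<close>

lemma level_meet_2:
  assumes [simp]: "x \<in> carrier L"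
  shows "level_meet L 2 x = level_meet L 3 x"
proof -
  define d where "d = pstar L (x\<acute>)"
  have [simp]: "d \<in> carrier L"
    by (simp add: d_def)
  have "level_meet L 2 x = (x \<sqinter> d) \<sqinter> x\<acute>\<acute>"
    by (simp add: numeral_2_eq_2 pstar_dneg_pstar_dneg d_def)
  moreover have "level_meet L 3 x = ((x \<sqinter> d) \<sqinter> x\<acute>\<acute>) \<sqinter> d"
    by (simp add: numeral_3_eq_3 pstar_dneg_pstar_dneg d_def dneg_dneg_dneg)
  ultimately show ?thesis
    by (simp add: meet_ac)
qed

end

lemma JID_subset_DQD_level: "JID \<subseteq> DQD_level 2"
proof
  fix L :: "'a dqd_sig"
  assume "L \<in> JID"
  then interpret jid_algebra L
    by (simp add: JID_def)
  show "L \<in> DQD_level 2"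
    using level_meet_2 dqd_algebra_axioms
    by (simp add: DQD_level_def DQD_def numeral_3_eq_3 numeral_2_eq_2 del: level_meet.simps)
qed


section \<open>The discriminator term\<close>

text \<open>The term \<open>t'' \<and> t'*\<close>, whose value is the core of the value of \<open>t\<close>.\<close>

definition core_term :: "sig_term \<Rightarrow> sig_term" where
  "core_term t = Meet (DNeg (DNeg t)) (Imp (DNeg t) Bot)"

text \<open>
  The term \<open>(c \<and> z) \<or> (c' \<and> x)\<close>, where \<open>c\<close> is the core of \<open>(x \<rightarrow> y) \<and> (y \<rightarrow> x)\<close> and
  \<open>x\<close>, \<open>y\<close>, \<open>z\<close> are the variables with the numbers 0, 1, 2.
\<close>

definition discriminator_term :: sig_term where
  "discriminator_term =
    (let c = core_term (Meet (Imp (Var 0) (Var 1)) (Imp (Var 1) (Var 0)))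
     in Join (Meet c (Var 2)) (Meet (DNeg c) (Var 0)))"

context dqd_algebra
begin

lemma term_val_core_term: "term_val L v (core_term t) = core (term_val L v t)"
  by (simp add: core_term_def core_def pstar_def)

lemma represents_discriminator_termI:
  assumes two_valued: "\<And>x. x \<in> carrier L \<Longrightarrow> core x = \<zero> \<or> core x = \<one>"
  shows "represents_discriminator discriminator_term L"
  unfolding represents_discriminator_def
proof (intro conjI allI impI)
  show "term_vars discriminator_term \<subseteq> {0, 1, 2}"
    by (simp add: discriminator_term_def core_term_def Let_def)
next
  fix v :: "nat \<Rightarrow> 'a"
  assume "range v \<subseteq> carrier L"
  then have [simp]: "v i \<in> carrier L" for i
    by auto
  define c where "c = core ((v 0 \<leadsto> v 1) \<sqinter> (v 1 \<leadsto> v 0))"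
  have c: "c = (if v 0 = v 1 then \<one> else \<zero>)"
    using two_valued[of "(v 0 \<leadsto> v 1) \<sqinter> (v 1 \<leadsto> v 0)"]
      core_eq_top_iff[of "(v 0 \<leadsto> v 1) \<sqinter> (v 1 \<leadsto> v 0)"] eq_iff_imps_eq_top[of "v 0" "v 1"]
    unfolding c_def by (metis closed(2,3) \<open>\<And>i. v i \<in> carrier L\<close>)
  have "term_val L v discriminator_term = (c \<sqinter> v 2) \<squnion> (c\<acute> \<sqinter> v 0)"
    by (simp add: discriminator_term_def Let_def term_val_core_term c_def)
  then show "term_val L v discriminator_term = (if v 0 = v 1 then v 2 else v 0)"
    by (simp add: c dneg_top dneg_bot)
qed

end


section \<open>JID as an equational class\<close>

text \<open>
  The axioms of JID-algebras as pairs of terms, with variables numbered from 0; the law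
  \<open>x'' \<le> x\<close> is the equation \<open>x'' \<and> x = x''\<close>.
\<close>

definition jid_identities :: "(sig_term \<times> sig_term) set" where
  "jid_identities =
    (let x = Var 0; y = Var 1; z = Var 2 in
     {(Join x y, Join y x),
      (Meet x y, Meet y x),
      (Join (Join x y) z, Join x (Join y z)),
      (Meet (Meet x y) z, Meet x (Meet y z)),
      (Join x (Meet x y), x),
      (Meet x (Join x y), x),
      (Meet x Bot, Bot),
      (Join x Top, Top),
      (Meet x (Imp x y), Meet x y),
      (Meet x (Imp y z), Meet x (Imp (Meet x y) (Meet x z))),
      (Imp x x, Top),
      (DNeg Bot, Top),
      (DNeg Top, Bot),
      (DNeg (Meet x y), Join (DNeg x) (DNeg y)),
      (DNeg (DNeg (Join x y)), Join (DNeg (DNeg x)) (DNeg (DNeg y))),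
      (Meet (DNeg (DNeg x)) x, DNeg (DNeg x)),
      (Join (DNeg x) (Imp y z), Imp (Join (DNeg x) y) (Join (DNeg x) z))})"

lemma (in jid_algebra) satisfies_jid_identities:
  assumes "e \<in> jid_identities"
  shows "satisfies_identity L e"
  unfolding satisfies_identity_def
proof (intro allI impI)
  fix v :: "nat \<Rightarrow> 'a"
  assume "range v \<subseteq> carrier L"
  then have [simp]: "v i \<in> carrier L" for i
    by auto
  show "term_val L v (fst e) = term_val L v (snd e)"
    using assms unfolding jid_identities_def Let_def insert_iff empty_iff
    by (elim disjE) (simp_all only: fst_conv snd_conv term_val.simps,
      (rule join_commute meet_commute join_assoc meet_assoc join_meet_absorb meet_join_absorb
        meet_bot join_top meet_imp meet_imp_meet imp_refl dneg_bot dneg_top dneg_meet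
        dneg_dneg_join dneg_dneg_le join_imp_distrib; simp)+)
qed

lemma jid_algebraI:
  assumes "sig_algebra L" and sat: "\<And>e. e \<in> jid_identities \<Longrightarrow> satisfies_identity L e"
  shows "jid_algebra L"
proof -
  interpret sig_algebra L
    by fact
  have "\<forall>e\<in>jid_identities.
      term_val L (\<lambda>i. if i = 0 then x else if i = 1 then y else z) (fst e) =
      term_val L (\<lambda>i. if i = 0 then x else if i = 1 then y else z) (snd e)"
    if "x \<in> carrier L" "y \<in> carrier L" "z \<in> carrier L" for x y z
  proof -
    have "range (\<lambda>i::nat. if i = 0 then x else if i = 1 then y else z) \<subseteq> carrier L"
      using that by auto
    then show ?thesis
      using sat by (simp add: satisfies_identity_def)
  qed
  note laws = this[unfolded jid_identities_def Let_def, simplified]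
  note laws1 = laws[OF _ bot_closed bot_closed]
  note laws0 = laws1[OF bot_closed]
  show ?thesis
    by (unfold_locales;
      (drule (2) laws | drule laws1 | insert laws0), elim conjE, assumption)
qed

lemma JID_eq_equational_class: "JID = equational_class jid_identities"
proof (intro equalityI subsetI)
  fix L :: "'a dqd_sig"
  assume "L \<in> JID"
  then interpret jid_algebra L
    by (simp add: JID_def)
  show "L \<in> equational_class jid_identities"
    by (simp add: equational_class_def sig_algebra_axioms satisfies_jid_identities)
qed (auto simp: JID_def equational_class_def intro: jid_algebraI)


section \<open>Quotients\<close>

text \<open>
  A quotient algebra, realized inside the carrier of \<open>L\<close> by a map \<open>r\<close> that sends each element
  to a chosen representative of its congruence class. Unlike an algebra of classes, it is again
  an algebra over the type \<open>'a\<close>.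
\<close>

definition quotient_algebra :: "'a dqd_sig \<Rightarrow> ('a \<Rightarrow> 'a) \<Rightarrow> 'a dqd_sig" where
  "quotient_algebra L r =
    \<lparr>carrier = r ` carrier L,
     join = (\<lambda>x y. r (x \<squnion>\<^bsub>L\<^esub> y)),
     meet = (\<lambda>x y. r (x \<sqinter>\<^bsub>L\<^esub> y)),
     imp = (\<lambda>x y. r (x \<leadsto>\<^bsub>L\<^esub> y)),
     dneg = (\<lambda>x. r (x\<acute>\<^bsub>L\<^esub>)),
     zero_elem = r \<zero>\<^bsub>L\<^esub>,
     one_elem = r \<one>\<^bsub>L\<^esub>\<rparr>"

text \<open>
  Compatibility of \<open>r\<close> with the operations. For \<open>r\<close> choosing a representative of each class of an
  equivalence relation, it says that the relation is a congruence.
\<close>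

locale representative_map = sig_algebra +
  fixes r :: "'a \<Rightarrow> 'a"
  assumes rep_closed [simp]: "x \<in> carrier L \<Longrightarrow> r x \<in> carrier L"
    and rep_join: "\<lbrakk>x \<in> carrier L; y \<in> carrier L\<rbrakk> \<Longrightarrow> r (r x \<squnion> r y) = r (x \<squnion> y)"
    and rep_meet: "\<lbrakk>x \<in> carrier L; y \<in> carrier L\<rbrakk> \<Longrightarrow> r (r x \<sqinter> r y) = r (x \<sqinter> y)"
    and rep_imp: "\<lbrakk>x \<in> carrier L; y \<in> carrier L\<rbrakk> \<Longrightarrow> r (r x \<leadsto> r y) = r (x \<leadsto> y)"
    and rep_dneg: "x \<in> carrier L \<Longrightarrow> r ((r x)\<acute>) = r (x\<acute>)"
begin

abbreviation Q :: "'a dqd_sig" where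
  "Q \<equiv> quotient_algebra L r"

lemma sig_algebra_quotient: "sig_algebra Q"
  by unfold_locales (auto simp: quotient_algebra_def)

lemma term_val_quotient:
  "range v \<subseteq> carrier L \<Longrightarrow> term_val Q (\<lambda>i. r (v i)) t = r (term_val L v t)"
  by (induction t)
    (simp_all add: quotient_algebra_def rep_join rep_meet rep_imp rep_dneg term_val_closed)

lemma satisfies_identity_quotient:
  assumes "satisfies_identity L e"
  shows "satisfies_identity Q e"
  unfolding satisfies_identity_def
proof (intro allI impI)
  fix w :: "nat \<Rightarrow> 'a"
  assume "range w \<subseteq> carrier Q"
  then have w: "w i \<in> r ` carrier L" for i
    by (auto simp: quotient_algebra_def)
  define v where "v i = inv_into (carrier L) r (w i)" for i
  have v: "range v \<subseteq> carrier L"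
    using w by (auto simp: v_def inv_into_into)
  have "w = (\<lambda>i. r (v i))"
    using w by (simp add: v_def f_inv_into_f)
  then show "term_val Q w (fst e) = term_val Q w (snd e)"
    using assms v by (simp add: term_val_quotient satisfies_identity_def)
qed

end


section \<open>Separating elements by quotients with a two-valued core\<close>

context jid_algebra
begin

text \<open>For central \<open>e\<close>, the relation \<open>x \<and> e = u \<and> e\<close> is compatible with all operations.\<close>

lemma central_cong:
  assumes e: "central e"
    and [simp]: "x \<in> carrier L" "y \<in> carrier L" "u \<in> carrier L" "v \<in> carrier L"
    and eq: "x \<sqinter> e = u \<sqinter> e" "y \<sqinter> e = v \<sqinter> e"
  shows "(x \<squnion> y) \<sqinter> e = (u \<squnion> v) \<sqinter> e" and "(x \<sqinter> y) \<sqinter> e = (u \<sqinter> v) \<sqinter> e"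
    and "(x \<leadsto> y) \<sqinter> e = (u \<leadsto> v) \<sqinter> e" and "x\<acute> \<sqinter> e = u\<acute> \<sqinter> e"
proof -
  have [simp]: "e \<in> carrier L" "e\<acute> \<sqinter> e = \<zero>"
    using e by (auto simp: central_def meet_commute)
  show "(x \<squnion> y) \<sqinter> e = (u \<squnion> v) \<sqinter> e"
    by (simp add: join_meet_distrib eq)
  have split: "(p \<sqinter> q) \<sqinter> e = (p \<sqinter> e) \<sqinter> (q \<sqinter> e)" if "p \<in> carrier L" "q \<in> carrier L" for p q
    using that by (simp add: meet_ac)
  show "(x \<sqinter> y) \<sqinter> e = (u \<sqinter> v) \<sqinter> e"
    by (simp add: split eq)
  have localize: "(p \<leadsto> q) \<sqinter> e = e \<sqinter> ((p \<sqinter> e) \<leadsto> (q \<sqinter> e))"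
    if "p \<in> carrier L" "q \<in> carrier L" for p q
    using that meet_imp_meet[of e p q] by (simp add: meet_commute)
  show "(x \<leadsto> y) \<sqinter> e = (u \<leadsto> v) \<sqinter> e"
    by (simp add: localize eq)
  have "p\<acute> \<sqinter> e = (p \<sqinter> e)\<acute> \<sqinter> e" if "p \<in> carrier L" for p
    using that by (simp add: dneg_meet join_meet_distrib)
  then show "x\<acute> \<sqinter> e = u\<acute> \<sqinter> e"
    using eq(1) by (metis assms(2,4))
qed

lemma cong_mono:
  assumes "x \<in> carrier L" "y \<in> carrier L" "e \<in> carrier L" "f \<in> carrier L" "x \<sqinter> e = y \<sqinter> e"
  shows "x \<sqinter> (e \<sqinter> f) = y \<sqinter> (e \<sqinter> f)" and "x \<sqinter> (f \<sqinter> e) = y \<sqinter> (f \<sqinter> e)"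
  using assms by (metis meet_assoc, metis meet_assoc meet_commute)

text \<open>
  By Zorn's lemma, the Boolean algebra of central elements has an ultrafilter containing no
  \<open>e\<close> with \<open>a \<and> e = b \<and> e\<close>. Only closure under meets is recorded, since the congruence induced
  by a set of central elements depends on the filter generated by that set alone.
\<close>

lemma separating_ultrafilter:
  assumes [simp]: "a \<in> carrier L" "b \<in> carrier L" and "a \<noteq> b"
  obtains U where "\<And>e. e \<in> U \<Longrightarrow> central e" "\<one> \<in> U" "\<And>e f. e \<in> U \<Longrightarrow> f \<in> U \<Longrightarrow> e \<sqinter> f \<in> U"
    "\<And>e. e \<in> U \<Longrightarrow> a \<sqinter> e \<noteq> b \<sqinter> e" "\<And>e. central e \<Longrightarrow> e \<in> U \<or> e\<acute> \<in> U"
proof -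
  define A where "A = {U. (\<forall>e\<in>U. central e \<and> a \<sqinter> e \<noteq> b \<sqinter> e) \<and> \<one> \<in> U \<and>
    (\<forall>e\<in>U. \<forall>f\<in>U. e \<sqinter> f \<in> U)}"
  have "{\<one>} \<in> A"
    using \<open>a \<noteq> b\<close> by (simp add: A_def central_top)
  then have "A \<noteq> {}"
    by blast
  moreover have "\<Union>\<C> \<in> A" if "\<C> \<noteq> {}" "subset.chain A \<C>" for \<C>
  proof -
    have sub: "\<C> \<subseteq> A" and tot: "\<And>V W. V \<in> \<C> \<Longrightarrow> W \<in> \<C> \<Longrightarrow> V \<subseteq> W \<or> W \<subseteq> V"
      using that(2) by (auto simp: subset.chain_def)
    have "e \<sqinter> f \<in> \<Union>\<C>" if "V \<in> \<C>" "e \<in> V" "W \<in> \<C>" "f \<in> W" for e f V W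
    proof -
      obtain X where "X \<in> \<C>" "e \<in> X" "f \<in> X"
        using tot[of V W] \<open>V \<in> \<C>\<close> \<open>e \<in> V\<close> \<open>W \<in> \<C>\<close> \<open>f \<in> W\<close> by blast
      then show ?thesis
        using sub by (auto simp: A_def)
    qed
    moreover have "central e \<and> a \<sqinter> e \<noteq> b \<sqinter> e" if "e \<in> V" "V \<in> \<C>" for e V
      using that sub by (auto simp: A_def)
    moreover have "\<one> \<in> \<Union>\<C>"
      using sub \<open>\<C> \<noteq> {}\<close> by (auto simp: A_def)
    ultimately show ?thesis
      unfolding A_def by blast
  qed
  ultimately obtain U where "U \<in> A" and maximal: "\<And>V. V \<in> A \<Longrightarrow> U \<subseteq> V \<Longrightarrow> V = U"
    using subset_Zorn_nonempty[of A] by metis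
  have central: "central e" and sep: "a \<sqinter> e \<noteq> b \<sqinter> e" if "e \<in> U" for e
    using \<open>U \<in> A\<close> that by (auto simp: A_def)
  have meet: "e \<sqinter> f \<in> U" if "e \<in> U" "f \<in> U" for e f
    using \<open>U \<in> A\<close> that by (auto simp: A_def)
  have top: "\<one> \<in> U"
    using \<open>U \<in> A\<close> by (auto simp: A_def)
  have blocked: "\<exists>f\<in>U. a \<sqinter> (f \<sqinter> e) = b \<sqinter> (f \<sqinter> e)" if e: "central e" "e \<notin> U" for e
  proof (rule ccontr)
    assume neg: "\<not> ?thesis"
    \<comment> \<open>Adjoining \<open>e = 1 \<and> e\<close> and its meets to \<open>U\<close> contradicts maximality.\<close>
    let ?V = "U \<union> {f \<sqinter> e |f. f \<in> U}"
    have [simp]: "e \<in> carrier L"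
      using e by simp
    have carr: "f \<in> carrier L" if "f \<in> U" for f
      using central[OF that] by simp
    have prod_V: "(f \<sqinter> g) \<sqinter> e \<in> ?V" if "f \<in> U" "g \<in> U" for f g
      using meet[OF that] by blast
    have prods: "f \<sqinter> (g \<sqinter> e) = (f \<sqinter> g) \<sqinter> e" "(f \<sqinter> e) \<sqinter> g = (f \<sqinter> g) \<sqinter> e"
      "(f \<sqinter> e) \<sqinter> (g \<sqinter> e) = (f \<sqinter> g) \<sqinter> e" if "f \<in> U" "g \<in> U" for f g
      using that by (simp_all add: carr meet_ac)
    have meet_V: "g \<sqinter> h \<in> ?V" if gh: "g \<in> ?V" "h \<in> ?V" for g h
    proof -
      from gh consider "g \<in> U" "h \<in> U" | f where "f \<in> U" "g = f \<sqinter> e" "h \<in> U"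
        | f where "f \<in> U" "h = f \<sqinter> e" "g \<in> U"
        | f f' where "f \<in> U" "g = f \<sqinter> e" "f' \<in> U" "h = f' \<sqinter> e"
        by blast
      then show ?thesis
      proof cases
        case 1
        then show ?thesis
          using meet by blast
      qed (simp_all only: prods prod_V)
    qed
    have sep_V: "central g \<and> a \<sqinter> g \<noteq> b \<sqinter> g" if "g \<in> ?V" for g
      using that neg central sep e(1) central_meet by blast
    have "?V \<in> A"
      unfolding A_def using meet_V sep_V top by blast
    then have "?V = U"
      using maximal by blast
    moreover have "\<one> \<sqinter> e \<in> ?V"
      using top by blast
    ultimately show False
      using e(2) by simp
  qed
  have "e \<in> U \<or> e\<acute> \<in> U" if e: "central e" for e
  proof (rule ccontr)
    assume "\<not> ?thesis"
    then obtain f g where fg: "f \<in> U" "g \<in> U" and f: "a \<sqinter> (f \<sqinter> e) = b \<sqinter> (f \<sqinter> e)"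
      and g: "a \<sqinter> (g \<sqinter> e\<acute>) = b \<sqinter> (g \<sqinter> e\<acute>)"
      using blocked[of e] blocked[of "e\<acute>"] e central_dneg[of e] by blast
    have [simp]: "e \<in> carrier L" "f \<in> carrier L" "g \<in> carrier L" "e \<squnion> e\<acute> = \<one>"
      using e central fg by (auto simp: central_def)
    \<comment> \<open>Agreement of \<open>a\<close> and \<open>b\<close> on \<open>f \<and> e\<close> and on \<open>g \<and> e'\<close> gives agreement on \<open>f \<and> g\<close>.\<close>
    have split: "p \<sqinter> (f \<sqinter> g) = (p \<sqinter> (g \<sqinter> (f \<sqinter> e))) \<squnion> (p \<sqinter> (f \<sqinter> (g \<sqinter> e\<acute>)))"
      if [simp]: "p \<in> carrier L" for p
    proof -
      have "p \<sqinter> (f \<sqinter> g) = (p \<sqinter> (f \<sqinter> g)) \<sqinter> (e \<squnion> e\<acute>)"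
        by simp
      also have "\<dots> = ((p \<sqinter> (f \<sqinter> g)) \<sqinter> e) \<squnion> ((p \<sqinter> (f \<sqinter> g)) \<sqinter> e\<acute>)"
        by (rule meet_join_distrib) simp_all
      also have "\<dots> = (p \<sqinter> (g \<sqinter> (f \<sqinter> e))) \<squnion> (p \<sqinter> (f \<sqinter> (g \<sqinter> e\<acute>)))"
        by (simp add: meet_assoc meet_left_commute[of f g])
      finally show ?thesis .
    qed
    have "a \<sqinter> (f \<sqinter> g) = b \<sqinter> (f \<sqinter> g)"
      using cong_mono(2)[OF _ _ _ _ f, of g] cong_mono(2)[OF _ _ _ _ g, of f]
      by (simp add: split)
    then show False
      using sep[OF meet[OF fg]] by blast
  qed
  then show thesis
    using that[of U] central sep top meet by blast
qed

text \<open>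
  The quotient by the ultrafilter: each core is central, so either it or its dual negation lies
  in the ultrafilter, and it becomes \<open>1\<close> or \<open>0\<close>.
\<close>

lemma separating_quotient:
  assumes "a \<in> carrier L" "b \<in> carrier L" "a \<noteq> b"
  obtains r where "representative_map L r" "r a \<noteq> r b"
    "jid_algebra (quotient_algebra L r)"
    "represents_discriminator discriminator_term (quotient_algebra L r)"
proof -
  obtain U where U: "\<And>e. e \<in> U \<Longrightarrow> central e" "\<one> \<in> U" "\<And>e f. e \<in> U \<Longrightarrow> f \<in> U \<Longrightarrow> e \<sqinter> f \<in> U"
    and sep: "\<And>e. e \<in> U \<Longrightarrow> a \<sqinter> e \<noteq> b \<sqinter> e"
    and ultra: "\<And>e. central e \<Longrightarrow> e \<in> U \<or> e\<acute> \<in> U"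
    using separating_ultrafilter[OF assms] by blast
  have [simp]: "e \<in> carrier L" if "e \<in> U" for e
    using U(1)[OF that] by simp
  define R where "R x y \<longleftrightarrow> (\<exists>e\<in>U. x \<sqinter> e = y \<sqinter> e)" for x y
  have common: "\<exists>e\<in>U. x \<sqinter> e = u \<sqinter> e \<and> y \<sqinter> e = v \<sqinter> e"
    if R: "R x u" "R y v"
      and carr: "x \<in> carrier L" "y \<in> carrier L" "u \<in> carrier L" "v \<in> carrier L"
    for x y u v
  proof -
    obtain e f where ef: "e \<in> U" "f \<in> U" "x \<sqinter> e = u \<sqinter> e" "y \<sqinter> f = v \<sqinter> f"
      using R unfolding R_def by blast
    then show ?thesis
      using cong_mono(1)[of x u e f] cong_mono(2)[of y v f e] carr U(3)[of e f]
      by (intro bexI[of _ "e \<sqinter> f"]) simp_all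
  qed
  have R_refl: "R x x" for x
    using U(2) by (auto simp: R_def)
  have R_sym: "R x y \<Longrightarrow> R y x" for x y
    by (metis R_def)
  have R_trans: "R x z"
    if "R x y" "R y z" "x \<in> carrier L" "y \<in> carrier L" "z \<in> carrier L" for x y z
    using common[OF that(1,2)] that(3-) by (metis R_def)
  define r where "r x = (SOME y. y \<in> carrier L \<and> R x y)" for x
  have r: "r x \<in> carrier L \<and> R x (r x)" if "x \<in> carrier L" for x
    unfolding r_def by (rule someI[of _ x]) (simp add: that R_refl)
  have r_eq: "r x = r y \<longleftrightarrow> R x y" if "x \<in> carrier L" "y \<in> carrier L" for x y
  proof
    assume "R x y"
    then have "y \<in> carrier L \<and> R x z \<longleftrightarrow> y \<in> carrier L \<and> R y z" if "z \<in> carrier L" for z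
      using R_trans R_sym that \<open>x \<in> carrier L\<close> \<open>y \<in> carrier L\<close> by blast
    then have "(\<lambda>z. z \<in> carrier L \<and> R x z) = (\<lambda>z. z \<in> carrier L \<and> R y z)"
      using that by auto
    then show "r x = r y"
      by (simp add: r_def)
  qed (metis R_trans R_sym r that)
  have rep: "representative_map L r"
  proof unfold_locales
    fix x y
    assume x: "x \<in> carrier L"
    then show "r x \<in> carrier L"
      using r by blast
    have r': "R (r z) z" if "z \<in> carrier L" for z
      using r R_sym that by blast
    obtain e where "e \<in> U" "r x \<sqinter> e = x \<sqinter> e"
      using r'[OF x] unfolding R_def by blast
    then have "R ((r x)\<acute>) (x\<acute>)"
      using central_cong(4)[of e "r x" "r x" x x] U(1) r x by (auto simp: R_def)
    then show "r ((r x)\<acute>) = r (x\<acute>)"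
      using r x by (simp add: r_eq)
    assume y: "y \<in> carrier L"
    obtain e where e: "central e" "e \<in> U" "r x \<sqinter> e = x \<sqinter> e" "r y \<sqinter> e = y \<sqinter> e"
      using common[OF r'[OF x] r'[OF y]] r x y U(1) by blast
    have [simp]: "r x \<in> carrier L" "r y \<in> carrier L"
      using r x y by auto
    note cong = central_cong[OF e(1) _ _ _ _ e(3,4)]
    show "r (r x \<squnion> r y) = r (x \<squnion> y)" "r (r x \<sqinter> r y) = r (x \<sqinter> y)"
      "r (r x \<leadsto> r y) = r (x \<leadsto> y)"
      using cong(1-3) x y e(2) by (auto simp: r_eq R_def)
  qed
  then interpret representative_map L r .
  have "jid_algebra Q"
    by (intro jid_algebraI sig_algebra_quotient satisfies_identity_quotient
        satisfies_jid_identities)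
  then interpret Q: jid_algebra Q .
  have "Q.core q = zero_elem Q \<or> Q.core q = one_elem Q" if q_in: "q \<in> carrier Q" for q
  proof -
    obtain x where q: "q = r x" and [simp]: "x \<in> carrier L"
      using q_in by (auto simp: quotient_algebra_def)
    have "central (core x)"
      by (simp add: central_core)
    then have [simp]: "core x \<sqinter> (core x)\<acute> = \<zero>"
      by (simp add: central_def)
    have "R (core x) \<one> \<or> R (core x) \<zero>"
      using ultra[OF \<open>central (core x)\<close>]
      by (auto simp: R_def intro: bexI[of _ "core x"] bexI[of _ "(core x)\<acute>"])
    moreover have "Q.core q = r (core x)"
      using term_val_quotient[of "\<lambda>_. x" "core_term (Var 0)"]
      by (simp add: term_val_core_term Q.term_val_core_term q)
    ultimately show ?thesis
      by (auto simp: quotient_algebra_def r_eq)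
  qed
  then have "represents_discriminator discriminator_term Q"
    by (intro Q.represents_discriminator_termI)
  moreover have "r a \<noteq> r b"
    using sep assms(1,2) by (auto simp: r_eq R_def)
  ultimately show thesis
    using that rep \<open>jid_algebra Q\<close> by blast
qed

end

lemma JID_eq_variety_generated_by:
  "JID = variety_generated_by {L \<in> JID. represents_discriminator discriminator_term L}"
  (is "_ = variety_generated_by ?K")
proof (intro equalityI subsetI)
  fix L :: "'a dqd_sig"
  assume "L \<in> JID"
  then interpret jid_algebra L
    by (simp add: JID_def)
  have "satisfies_identity L e" if K: "\<And>M. M \<in> ?K \<Longrightarrow> satisfies_identity M e" for e
    unfolding satisfies_identity_def
  proof (intro allI impI, rule ccontr)
    fix v
    assume v: "range v \<subseteq> carrier L" and "term_val L v (fst e) \<noteq> term_val L v (snd e)"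
    then obtain r where r: "representative_map L r"
      and neq: "r (term_val L v (fst e)) \<noteq> r (term_val L v (snd e))"
      and Q: "jid_algebra (quotient_algebra L r)"
        "represents_discriminator discriminator_term (quotient_algebra L r)"
      using separating_quotient term_val_closed by metis
    interpret representative_map L r
      by fact
    have "satisfies_identity Q e"
      using K Q by (simp add: JID_def)
    moreover have "range (\<lambda>i. r (v i)) \<subseteq> carrier Q"
      using v by (auto simp: quotient_algebra_def)
    ultimately show False
      using neq term_val_quotient[OF v] unfolding satisfies_identity_def by metis
  qed
  then show "L \<in> variety_generated_by ?K"
    using sig_algebra_axioms
    by (fastforce simp: variety_generated_by_def variety_def equational_class_def)
next
  fix L :: "'a dqd_sig"
  assume "L \<in> variety_generated_by ?K"
  moreover have "variety JID"
    using JID_eq_equational_class by (auto simp: variety_def)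
  ultimately show "L \<in> JID"
    by (auto simp: variety_generated_by_def)
qed

theorem corollary3p11:
  "discriminator_variety (JID :: 'a dqd_sig set) \<and> (JID :: 'a dqd_sig set) \<subseteq> DQD_level 2"
proof
  have "sig_algebra L" if "L \<in> JID" for L :: "'a dqd_sig"
    using that JID_eq_equational_class by (auto simp: equational_class_def)
  then show "discriminator_variety (JID :: 'a dqd_sig set)"
    unfolding discriminator_variety_def
    by (intro exI[of _ "{L \<in> JID. represents_discriminator discriminator_term L}"]
        exI[of _ discriminator_term] conjI JID_eq_variety_generated_by) blast
qed (rule JID_subset_DQD_level)

end
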